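(* (Closure) For all $P_0, P_1 \in EC \setminus \{\infty\}$, $P_0 \oplus P_1 \in EC$.
   Context: Let $\wp = 2^{255}-19$ (a prime), $A = 486662$, and let $\mathbb{F}_\wp$ be the field of order $\wp$. Let $EC = \{(x,y) \in \mathbb{F}_\wp \times \mathbb{F}_\wp \mid y^2 = x^3 + Ax^2 + x\} \cup \{\infty\}$, where $\infty$ is a formal extra point. The operation $\oplus$ on points $P, Q \in EC$ is defined by: (1) $P \oplus \infty = \infty \oplus P = P$. (2) If $P = (x,y)$, then $P \oplus (x,-y) = \infty$. (3) If $P = (x_1,y_1)$ and $Q = (x_2,y_2) \neq (x_1,-y_1)$, let $\lambda = \frac{y_2-y_1}{x_2-x_1}$ if $x_1 \neq x_2$ and $\lambda = \frac{3x_1^2+2Ax_1+1}{2y_1}$ if $x_1 = x_2$; then $P \oplus Q = (x,y)$, where $x = \lambda^2 - A - x_1 - x_2$ and $y = \lambda(x_1 - x) - y_1$. All arithmetic is in $\mathbb{F}_\wp$. *)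

theory Defs
  imports "HOL-Library.Cardinality"
begin

definition wp :: nat
  where "wp = 2 ^ 255 - 19"

(* The field of order wp is rendered as an arbitrary type 'a of class field with CARD('a) = wp;
   CARD is 0 on infinite types, so this equation also forces 'a to be finite. *)

abbreviation curve_A :: "'a::field"
  where "curve_A \<equiv> 486662"

datatype 'a point = Infinity | Point 'a 'a

definition EC :: "'a::field point set"
  where "EC = {Point x y | x y. y ^ 2 = x ^ 3 + curve_A * x ^ 2 + x} \<union> {Infinity}"

(* Total on the type of points. The convention z / 0 = 0 is only visible for points off the
   curve: a doubling with y1 = 0 has already been caught by the test for Infinity. *)
fun ec_add :: "'a::field point \<Rightarrow> 'a point \<Rightarrow> 'a point"
  where
    "ec_add P Infinity = P"
  | "ec_add Infinity Q = Q"
  | "ec_add (Point x1 y1) (Point x2 y2) =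
      (if x2 = x1 \<and> y2 = - y1 then Infinity
       else
         let l = (if x1 \<noteq> x2 then (y2 - y1) / (x2 - x1)
                  else (3 * x1 ^ 2 + 2 * curve_A * x1 + 1) / (2 * y1));
             x = l ^ 2 - curve_A - x1 - x2;
             y = l * (x1 - x) - y1
         in Point x y)"

end

(* The line of slope l through P0 cuts the cubic in the roots of (x - x1) * q(x), where q is a monic
   quadratic. Whether the line is a chord or a tangent, x2 is a root of q, so by Vieta the remaining
   root is l^2 - A - x1 - x2, and P0 + P1 is the reflection of the third intersection point. *)

theory Submission
  imports Defs
begin

text \<open>Substituting \<open>y1 + l * (t - x1)\<close> for the ordinate and subtracting the
  equation of \<open>(x1, y1)\<close> leaves \<open>(t - x1)\<close> times a quadratic in
  \<open>t\<close>. The second hypothesis says that \<open>x2\<close> is a root of it; this form,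
  free of division, covers chord and tangent alike.\<close>

lemma third_intersection_on_cubic:
  fixes A :: "'a::comm_ring_1"
  assumes "y1 ^ 2 = x1 ^ 3 + A * x1 ^ 2 + x1"
    and "x2 ^ 2 + x2 * x1 + x1 ^ 2 + A * (x2 + x1) + 1 - l ^ 2 * (x2 - x1) - 2 * l * y1 = 0"
    and x: "x = l ^ 2 - A - x1 - x2"
    and y: "y = l * (x1 - x) - y1"
  shows "y ^ 2 = x ^ 3 + A * x ^ 2 + x"
proof -
  define q where
    "q t = t ^ 2 + t * x1 + x1 ^ 2 + A * (t + x1) + 1 - l ^ 2 * (t - x1) - 2 * l * y1" for t
  \<comment> \<open>Vieta as a factorization: the choice of \<open>x\<close> makes the second factor
    vanish.\<close>
  have "q x - q x2 = (x - x2) * (x + x2 + x1 + A - l ^ 2)"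
    unfolding q_def by (simp add: algebra_simps power2_eq_square)
  moreover have "x + x2 + x1 + A - l ^ 2 = 0"
    unfolding x by simp
  moreover have "q x2 = 0"
    unfolding q_def by (rule assms(2))
  ultimately have "q x = 0"
    by simp
  \<comment> \<open>\<open>y\<close> is minus the ordinate of the line at \<open>x\<close>, so its
    square is that of the line.\<close>
  moreover have "x ^ 3 + A * x ^ 2 + x - y ^ 2
      = (x - x1) * q x + (x1 ^ 3 + A * x1 ^ 2 + x1 - y1 ^ 2)"
    unfolding q_def y by (simp add: algebra_simps power2_eq_square power3_eq_cube)
  ultimately have "x ^ 3 + A * x ^ 2 + x - y ^ 2 = 0"
    by (simp only: assms(1) mult_zero_right diff_self add_0_right)
  then show ?thesis
    by (simp only: right_minus_eq)
qed

text \<open>Multiplied by \<open>x2 - x1\<close>, the quadratic becomes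
  \<open>y2 ^ 2 - y1 ^ 2 - (y2 - y1) ^ 2 - 2 * y1 * (y2 - y1)\<close>, which is zero; the nonzero
  factor cancels.\<close>

lemma chord_quadratic:
  fixes A :: "'a::field"
  assumes "y1 ^ 2 = x1 ^ 3 + A * x1 ^ 2 + x1" "y2 ^ 2 = x2 ^ 3 + A * x2 ^ 2 + x2"
    and "x1 \<noteq> x2" and "l = (y2 - y1) / (x2 - x1)"
  shows "x2 ^ 2 + x2 * x1 + x1 ^ 2 + A * (x2 + x1) + 1 - l ^ 2 * (x2 - x1) - 2 * l * y1 = 0"
    (is "?q = 0")
proof -
  have "l * (x2 - x1) = y2 - y1"
    using assms(3,4) by simp
  then have "(x2 - x1) * ?q = 0"
    using assms(1,2) by algebra
  then show ?thesis
    using assms(3) by simp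
qed

text \<open>At \<open>x2 = x1\<close> the \<open>l ^ 2\<close> term drops out, and what remains is
  the defining equation of the tangent slope cleared of its denominator.\<close>

lemma tangent_quadratic:
  fixes A :: "'a::field"
  assumes "2 * y1 \<noteq> 0" and "l = (3 * x1 ^ 2 + 2 * A * x1 + 1) / (2 * y1)"
  shows "x1 ^ 2 + x1 * x1 + x1 ^ 2 + A * (x1 + x1) + 1 - l ^ 2 * (x1 - x1) - 2 * l * y1 = 0"
proof -
  have "l * (2 * y1) = 3 * x1 ^ 2 + 2 * A * x1 + 1"
    unfolding assms(2) using assms(1) by (rule nonzero_eq_divide_eq[THEN iffD1, OF _ refl])
  then show ?thesis by algebra
qed

theorem lemma7p1:
  fixes P0 P1 :: "'a::field point"
  assumes "CARD('a) = wp"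
    and "P0 \<in> EC - {Infinity}"
    and "P1 \<in> EC - {Infinity}"
  shows "ec_add P0 P1 \<in> EC"
proof -
  obtain x1 y1 where P0: "P0 = Point x1 y1" and c1: "y1 ^ 2 = x1 ^ 3 + curve_A * x1 ^ 2 + x1"
    using assms(2) by (auto simp: EC_def)
  obtain x2 y2 where P1: "P1 = Point x2 y2" and c2: "y2 ^ 2 = x2 ^ 3 + curve_A * x2 ^ 2 + x2"
    using assms(3) by (auto simp: EC_def)
  show ?thesis
  proof (cases "x2 = x1 \<and> y2 = - y1")
    case True
    then show ?thesis by (simp add: P0 P1 EC_def)
  next
    case False
    define l where "l = (if x1 \<noteq> x2 then (y2 - y1) / (x2 - x1)
      else (3 * x1 ^ 2 + 2 * curve_A * x1 + 1) / (2 * y1))"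
    define x where "x = l ^ 2 - curve_A - x1 - x2"
    define y where "y = l * (x1 - x) - y1"
    have sum: "ec_add P0 P1 = Point x y"
      using False unfolding P0 P1 ec_add.simps Let_def l_def x_def y_def by (simp only: if_False)
    have "x2 ^ 2 + x2 * x1 + x1 ^ 2 + curve_A * (x2 + x1) + 1
      - l ^ 2 * (x2 - x1) - 2 * l * y1 = 0"
    proof (cases "x1 = x2")
      case True
      then have "y2 ^ 2 = y1 ^ 2"
        by (simp only: c1 c2)
      then have "y2 = y1"
        using False True by (simp add: power2_eq_iff)
      \<comment> \<open>The excluded case \<open>y2 = - y1\<close> now reads
        \<open>y1 = - y1\<close>, so the denominator \<open>2 * y1\<close> of the slope is
        nonzero.\<close>
      then have "y1 \<noteq> - y1"
        using False True by blast
      then have "2 * y1 \<noteq> 0"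
        by (simp only: mult_2 eq_neg_iff_add_eq_0 not_False_eq_True)
      moreover have "l = (3 * x1 ^ 2 + 2 * curve_A * x1 + 1) / (2 * y1)"
        by (simp only: l_def True not_True_eq_False if_False simp_thms)
      ultimately show ?thesis
        unfolding True[symmetric] by (rule tangent_quadratic)
    next
      case False
      then have "l = (y2 - y1) / (x2 - x1)"
        by (simp only: l_def if_True not_False_eq_True)
      then show ?thesis
        by (rule chord_quadratic[OF c1 c2 False])
    qed
    from third_intersection_on_cubic[OF c1 this x_def y_def]
    show ?thesis
      unfolding sum EC_def by blast
  qed
qed

end
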